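(* Let $T\subset\mathbb{C}$ be a triangle with vertices $A,B,C$ and let $\tilde T\subset\mathbb{C}$ be a triangle with vertices $\tilde A,\tilde B,\tilde C$, where the vertices are labeled in the same orientation. Of all projective transformations that map $T$ onto $\tilde T$ and $A,B,C$ to $\tilde A,\tilde B,\tilde C$, respectively (these are orientation preserving on $T$), the one that maps the angle bisectors of $T$ to the corresponding angle bisectors of $\tilde T$ simultaneously minimizes $|\mu(A)|$, $|\mu(B)|$ and $|\mu(C)|$. That is, the angle bisector preserving projective transformation $f$ satisfies $$|\mu_f(A)|\le|\mu_g(A)|,\quad |\mu_f(B)|\le|\mu_g(B)|,\quad |\mu_f(C)|\le|\mu_g(C)|$$ for all projective transformations $g$ with $g(A)=\tilde A$, $g(B)=\tilde B$, $g(C)=\tilde C$, $g(T)=\tilde T$.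
   Context: A projective transformation is a map $f:\mathbb{R}\mathrm{P}^2\to\mathbb{R}\mathrm{P}^2$, $[x]\mapsto[Mx]$ with $M\in \mathrm{GL}_3(\mathbb{R})$. The complement of the line at infinity $\ell_\infty=\{[x] : x_3=0\}$ is identified with $\mathbb{C}$ via $z=x+iy\leftrightarrow[(x,y,1)]$. For a real differentiable map $f$ from an open subset of $\mathbb{C}$ to $\mathbb{C}$ with nowhere vanishing derivative, the Beltrami coefficient is $\mu_f=f_{\bar z}/f_z$, where $f_z=\frac12(f_x-if_y)$ and $f_{\bar z}=\frac12(f_x+if_y)$. Its modulus $|\mu_f|\in[0,\infty]$ is called the eccentricity. "Triangle" means closed triangular region (nondegenerate). "Angle bisectors" are the interior angle bisectors at the three vertices. The angle bisector preserving projective transformation $f$ is the projective transformation with $f(A)=\tilde A$, $f(B)=\tilde B$, $f(C)=\tilde C$, $f(T)=\tilde T$ that maps the angle bisector at each vertex of $T$ to the angle bisector at the corresponding vertex of $\tilde T$; equivalently, it maps the vertices to the vertices and the incircle center to the incircle center. *)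

theory Defs
  imports "HOL-Analysis.Analysis"
begin

section \<open>The real projective plane\<close>

definition proj_equiv :: "real^3 \<Rightarrow> real^3 \<Rightarrow> bool" where
  "proj_equiv x y \<longleftrightarrow> x \<noteq> 0 \<and> y \<noteq> 0 \<and> (\<exists>c. y = c *\<^sub>R x)"

lemma part_equivp_proj_equiv: "part_equivp proj_equiv"
proof (rule part_equivpI)
  have "proj_equiv (axis 1 1) (axis 1 1)"
    unfolding proj_equiv_def by (auto intro: exI[of _ 1] simp: axis_eq_0_iff)
  then show "\<exists>x. proj_equiv x x" ..
  show "symp proj_equiv"
  proof (rule sympI)
    fix x y assume xy: "proj_equiv x y"
    then obtain c where c: "y = c *\<^sub>R x" "c \<noteq> 0"
      unfolding proj_equiv_def by auto
    then have "x = inverse c *\<^sub>R y" by simp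
    with xy show "proj_equiv y x"
      unfolding proj_equiv_def by blast
  qed
  show "transp proj_equiv"
    by (rule transpI) (auto simp: proj_equiv_def)
qed

quotient_type rp2 = "real^3" / partial: proj_equiv
  by (rule part_equivp_proj_equiv)

text \<open>The point \<open>[x]\<close> of the projective plane; only meaningful for \<open>x \<noteq> 0\<close>.\<close>

definition proj_point :: "real^3 \<Rightarrow> rp2" where
  "proj_point x = abs_rp2 x"

definition projective_transformation :: "(rp2 \<Rightarrow> rp2) \<Rightarrow> bool" where
  "projective_transformation f \<longleftrightarrow>
     (\<exists>M::real^3^3. invertible M \<and> (\<forall>x. x \<noteq> 0 \<longrightarrow> f (proj_point x) = proj_point (M *v x)))"

definition affine_point :: "complex \<Rightarrow> rp2" where
  "affine_point z = proj_point (vector [Re z, Im z, 1])"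

text \<open>
  The map \<open>f\<close> read in the affine chart.  Its values are unspecified at those \<open>z\<close> that \<open>f\<close> sends to
  the line at infinity.  For a projective transformation these \<open>z\<close> form a closed set, so derivatives
  of \<open>in_chart f\<close> at all other points do not depend on the unspecified values.
\<close>

definition in_chart :: "(rp2 \<Rightarrow> rp2) \<Rightarrow> complex \<Rightarrow> complex" where
  "in_chart f z = (THE w. affine_point w = f (affine_point z))"


section \<open>Beltrami coefficient and eccentricity\<close>

definition partial_x :: "(complex \<Rightarrow> complex) \<Rightarrow> complex \<Rightarrow> complex" where
  "partial_x F z = frechet_derivative F (at z) 1"

definition partial_y :: "(complex \<Rightarrow> complex) \<Rightarrow> complex \<Rightarrow> complex" where
  "partial_y F z = frechet_derivative F (at z) \<i>"

definition wirtinger_z :: "(complex \<Rightarrow> complex) \<Rightarrow> complex \<Rightarrow> complex" where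
  "wirtinger_z F z = (partial_x F z - \<i> * partial_y F z) / 2"

definition wirtinger_zbar :: "(complex \<Rightarrow> complex) \<Rightarrow> complex \<Rightarrow> complex" where
  "wirtinger_zbar F z = (partial_x F z + \<i> * partial_y F z) / 2"

definition beltrami :: "(complex \<Rightarrow> complex) \<Rightarrow> complex \<Rightarrow> complex" where
  "beltrami F z = wirtinger_zbar F z / wirtinger_z F z"

text \<open>
  The modulus of the Beltrami coefficient as an element of \<open>[0,\<infinity>]\<close>.  The case distinction
  replaces the totalised value \<open>x / 0 = 0\<close> by the intended \<open>\<infinity>\<close> (the derivative is assumed to be
  nonzero, so the two Wirtinger derivatives do not vanish simultaneously).
\<close>

definition eccentricity :: "(complex \<Rightarrow> complex) \<Rightarrow> complex \<Rightarrow> ennreal" where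
  "eccentricity F z =
     (if wirtinger_z F z = 0 then \<infinity> else ennreal (cmod (beltrami F z)))"

text \<open>\<open>Im (cnj u * v)\<close> is the determinant of the real 2 by 2 matrix with columns \<open>u\<close> and \<open>v\<close>.\<close>

definition orientation_preserving_at :: "(complex \<Rightarrow> complex) \<Rightarrow> complex \<Rightarrow> bool" where
  "orientation_preserving_at F z \<longleftrightarrow>
     F differentiable (at z) \<and> Im (cnj (partial_x F z) * partial_y F z) > 0"


section \<open>Triangles\<close>

definition triangle_region :: "complex \<Rightarrow> complex \<Rightarrow> complex \<Rightarrow> complex set" where
  "triangle_region A B C = convex hull {A, B, C}"

definition orientation :: "complex \<Rightarrow> complex \<Rightarrow> complex \<Rightarrow> real" where
  "orientation A B C = sgn (Im (cnj (B - A) * (C - A)))"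

text \<open>The unoriented angle at \<open>Q\<close>, in \<open>[0,\<pi>]\<close>, for \<open>P \<noteq> Q\<close> and \<open>R \<noteq> Q\<close>.\<close>

definition angle :: "complex \<Rightarrow> complex \<Rightarrow> complex \<Rightarrow> real" where
  "angle P Q R = \<bar>Arg ((P - Q) / (R - Q))\<bar>"

text \<open>
  The interior angle bisector at \<open>A\<close> of the triangle with vertices \<open>A\<close>, \<open>B\<close>, \<open>C\<close>, as the segment
  from \<open>A\<close> to the opposite side.
\<close>

definition angle_bisector :: "complex \<Rightarrow> complex \<Rightarrow> complex \<Rightarrow> complex set" where
  "angle_bisector A B C = {z \<in> triangle_region A B C. z = A \<or> angle B A z = angle z A C}"

definition maps_triangle ::
  "complex \<Rightarrow> complex \<Rightarrow> complex \<Rightarrow> complex \<Rightarrow> complex \<Rightarrow> complex \<Rightarrow> (rp2 \<Rightarrow> rp2) \<Rightarrow> bool" where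
  "maps_triangle A B C A' B' C' f \<longleftrightarrow>
     projective_transformation f \<and>
     f (affine_point A) = affine_point A' \<and>
     f (affine_point B) = affine_point B' \<and>
     f (affine_point C) = affine_point C' \<and>
     f ` affine_point ` triangle_region A B C = affine_point ` triangle_region A' B' C'"

definition bisector_preserving ::
  "complex \<Rightarrow> complex \<Rightarrow> complex \<Rightarrow> complex \<Rightarrow> complex \<Rightarrow> complex \<Rightarrow> (rp2 \<Rightarrow> rp2) \<Rightarrow> bool" where
  "bisector_preserving A B C A' B' C' f \<longleftrightarrow>
     maps_triangle A B C A' B' C' f \<and>
     f ` affine_point ` angle_bisector A B C = affine_point ` angle_bisector A' B' C' \<and>
     f ` affine_point ` angle_bisector B C A = affine_point ` angle_bisector B' C' A' \<and>
     f ` affine_point ` angle_bisector C A B = affine_point ` angle_bisector C' A' B'"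

end

theory Submission
  imports Defs
begin

text \<open>
  Write points of the projective plane in homogeneous barycentric coordinates \<open>x : y : z\<close> with respect
  to the vertices (\<open>bary\<close>).  A projective transformation that sends \<open>A, B, C\<close> to \<open>A', B', C'\<close> is a
  diagonal map \<open>x : y : z \<mapsto> \<alpha> x : \<beta> y : \<gamma> z\<close>, and it sends the triangle onto the triangle exactly if
  the weights \<open>\<alpha>, \<beta>, \<gamma>\<close> have the same sign, hence can be taken positive
  (\<open>maps_triangle_imp_diagonal_map\<close>, \<open>diagonal_map_imp_maps_triangle\<close>).  Weights are determined up to
  a common factor, so the maps in question form a two-parameter family.

  The bisector at \<open>A\<close> is the part of the triangle on the line \<open>y / \<bar>CA\<bar> = z / \<bar>AB\<bar>\<close>.  A diagonal map
  preserves it iff \<open>\<beta> \<bar>CA\<bar> / \<bar>C'A'\<bar> = \<gamma> \<bar>AB\<bar> / \<bar>A'B'\<bar>\<close> (\<open>diagonal_map_bisector_iff\<close>).  The three conditions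
  together say that \<open>\<alpha> : \<beta> : \<gamma>\<close> is the triple of ratios of corresponding sides,
  \<open>\<bar>B'C'\<bar> / \<bar>BC\<bar> : \<bar>C'A'\<bar> / \<bar>CA\<bar> : \<bar>A'B'\<bar> / \<bar>AB\<bar>\<close>, which gives existence and uniqueness.

  The derivative at \<open>A\<close> of the map in the affine chart sends \<open>B - A\<close> to \<open>(\<beta> / \<alpha>) (B' - A')\<close> and \<open>C - A\<close>
  to \<open>(\<gamma> / \<alpha>) (C' - A')\<close>.  If \<open>\<theta>, \<theta>'\<close> are the angles at \<open>A, A'\<close> and
  \<open>P = \<beta> \<bar>A'B'\<bar> \<bar>CA\<bar>\<close>, \<open>Q = \<gamma> \<bar>C'A'\<bar> \<bar>AB\<bar>\<close>, then the squared eccentricity at \<open>A\<close> is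
  \<open>(P\<^sup>2 + Q\<^sup>2 - 2 P Q cos (\<theta> - \<theta>')) / (P\<^sup>2 + Q\<^sup>2 - 2 P Q cos (\<theta> + \<theta>'))\<close>.  Equal orientation gives
  \<open>cos (\<theta> + \<theta>') < cos (\<theta> - \<theta>')\<close>, so this is an increasing function of \<open>P / Q + Q / P\<close>, which is least
  for \<open>P = Q\<close>: precisely when the bisector at \<open>A\<close> is preserved (\<open>wirtinger_quotient_minimal\<close>).
  The other vertices follow by cyclic relabelling.

  The Jacobian determinant of the diagonal map in affine coordinates along the two sides at \<open>A\<close> is
  \<open>\<alpha> \<beta> \<gamma> / D\<^sup>3\<close>, where \<open>D\<close> is the last homogeneous coordinate of the image of the lifted point.
  The weights are positive, so \<open>D\<close> and the determinant are positive on the triangle; as the triangles are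
  equally oriented, the maps preserve orientation there.
\<close>

section \<open>Homogeneous barycentric coordinates\<close>

text \<open>The determinant of the real 2 by 2 matrix with columns \<open>u\<close> and \<open>v\<close>.\<close>

definition det2 :: "complex \<Rightarrow> complex \<Rightarrow> real" where
  "det2 u v = Im (cnj u * v)"

lemma det2_alt: "det2 u v = Re u * Im v - Im u * Re v"
  by (simp add: det2_def)

lemma orientation_det2: "orientation A B C = sgn (det2 (B - A) (C - A))"
  by (simp add: orientation_def det2_def)

lemma det2_rotate:
  fixes A B C :: complex
  shows "det2 (C - B) (A - B) = det2 (B - A) (C - A)"
    and "det2 (A - C) (B - C) = det2 (B - A) (C - A)"
  by (simp_all add: det2_alt algebra_simps)

lemma det2_nonzero_if_noncollinear:
  assumes "\<not> collinear {A, B, C}"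
  shows "det2 (B - A) (C - A) \<noteq> 0"
proof
  assume 0: "det2 (B - A) (C - A) = 0"
  have "Im ((C - A) / (B - A)) = 0"
    using 0 by (simp add: det2_alt Im_divide algebra_simps)
  then have "collinear {0, B - A, C - A}"
    by (simp add: collinear_iff_Reals complex_is_Real_iff)
  then have "collinear {B, A, C}"
    by (simp add: collinear_3)
  with assms show False
    by (simp add: insert_commute)
qed

definition lift :: "complex \<Rightarrow> real^3" where
  "lift z = vector [Re z, Im z, 1]"

lemma lift_nth [simp]: "lift z $ 1 = Re z" "lift z $ 2 = Im z" "lift z $ 3 = 1"
  by (simp_all add: lift_def)

definition comb :: "complex \<Rightarrow> complex \<Rightarrow> complex \<Rightarrow> real \<Rightarrow> real \<Rightarrow> real \<Rightarrow> real^3" where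
  "comb A B C x y z = x *\<^sub>R lift A + y *\<^sub>R lift B + z *\<^sub>R lift C"

definition bary :: "complex \<Rightarrow> complex \<Rightarrow> complex \<Rightarrow> real \<Rightarrow> real \<Rightarrow> real \<Rightarrow> rp2" where
  "bary A B C x y z = proj_point (comb A B C x y z)"

lemma comb_rotate: "comb B C A y z x = comb A B C x y z"
  by (simp add: comb_def)

lemma bary_rotate: "bary B C A y z x = bary A B C x y z"
  by (simp add: bary_def comb_rotate)

text \<open>
  The matrix that turns barycentric into homogeneous affine coordinates.  Its determinant is twice the
  signed area of the triangle, so for a nondegenerate triangle \<open>comb\<close> is a linear isomorphism.
\<close>

definition comb_matrix :: "complex \<Rightarrow> complex \<Rightarrow> complex \<Rightarrow> real^3^3" where
  "comb_matrix A B C = transpose (vector [lift A, lift B, lift C])"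

lemma comb_matrix_mult: "comb_matrix A B C *v v = comb A B C (v $ 1) (v $ 2) (v $ 3)"
  by (simp add: vec_eq_iff forall_3 matrix_vector_mult_def sum_3 comb_matrix_def
      transpose_def comb_def algebra_simps)

lemma det_comb_matrix: "det (comb_matrix A B C) = det2 (B - A) (C - A)"
  by (simp add: det_3 comb_matrix_def transpose_def det2_alt algebra_simps)

lemma invertible_comb_matrix:
  "det2 (B - A) (C - A) \<noteq> 0 \<Longrightarrow> invertible (comb_matrix A B C)"
  by (simp add: invertible_det_nz det_comb_matrix)

lemma matrix_inv_mult:
  assumes "invertible N"
  shows "matrix_inv N ** N = mat 1" "N ** matrix_inv N = mat 1"
  using someI_ex[OF assms[unfolded invertible_def]] unfolding matrix_inv_def by auto

lemma comb_surj:
  assumes "det2 (B - A) (C - A) \<noteq> 0"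
  obtains x y z where "v = comb A B C x y z"
proof -
  have "v = comb_matrix A B C *v (matrix_inv (comb_matrix A B C) *v v)"
    using matrix_inv_mult(2)[OF invertible_comb_matrix[OF assms]]
    by (simp add: matrix_vector_mul_assoc)
  then show thesis
    using that unfolding comb_matrix_mult by blast
qed

lemma comb_inject:
  assumes "det2 (B - A) (C - A) \<noteq> 0"
    and "comb A B C x y z = comb A B C x' y' z'"
  shows "x = x'" "y = y'" "z = z'"
proof -
  have "comb_matrix A B C *v vector [x, y, z] = comb_matrix A B C *v vector [x', y', z']"
    using assms(2) by (simp add: comb_matrix_mult)
  then have "matrix_inv (comb_matrix A B C) *v (comb_matrix A B C *v vector [x, y, z]) =
      matrix_inv (comb_matrix A B C) *v (comb_matrix A B C *v vector [x', y', z'])"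
    by simp
  then have "(vector [x, y, z] :: real^3) = vector [x', y', z']"
    using matrix_inv_mult(1)[OF invertible_comb_matrix[OF assms(1)]]
    by (simp add: matrix_vector_mul_assoc)
  then show "x = x'" "y = y'" "z = z'"
    by (metis vector_3)+
qed

lemma comb_scale: "comb A B C (k * x) (k * y) (k * z) = k *\<^sub>R comb A B C x y z"
  by (simp add: comb_def algebra_simps)

lemma comb_zero [simp]: "comb A B C 0 0 0 = 0"
  by (simp add: comb_def)

lemma comb_eq_0_iff:
  "det2 (B - A) (C - A) \<noteq> 0 \<Longrightarrow> comb A B C x y z = 0 \<longleftrightarrow> x = 0 \<and> y = 0 \<and> z = 0"
  by (metis comb_inject comb_zero)

lemma proj_point_eq_iff:
  assumes "v \<noteq> 0" "w \<noteq> 0"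
  shows "proj_point v = proj_point w \<longleftrightarrow> (\<exists>k. w = k *\<^sub>R v)"
proof -
  have "proj_equiv v v" "proj_equiv w w"
    using assms by (auto simp: proj_equiv_def intro: exI[of _ 1])
  then have "proj_equiv v w \<longleftrightarrow> abs_rp2 v = abs_rp2 w"
    using Quotient3_rel[OF Quotient3_rp2, of v w] by blast
  then show ?thesis
    using assms by (simp add: proj_point_def proj_equiv_def)
qed

lemma proj_point_scale:
  assumes "k \<noteq> 0"
  shows "proj_point (k *\<^sub>R v) = proj_point v"
proof (cases "v = 0")
  case False
  then have "k *\<^sub>R v \<noteq> 0"
    using assms by simp
  then show ?thesis
    using proj_point_eq_iff[OF False] by metis
qed simp

lemma rep_rp2_nonzero: "rep_rp2 r \<noteq> 0"
  and proj_point_rep_rp2: "proj_point (rep_rp2 r) = r"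
proof -
  have "proj_equiv (rep_rp2 r) (rep_rp2 r)"
    by (rule Quotient3_rep_reflp[OF Quotient3_rp2])
  then show "rep_rp2 r \<noteq> 0"
    by (simp add: proj_equiv_def)
  show "proj_point (rep_rp2 r) = r"
    unfolding proj_point_def by (rule Quotient3_abs_rep[OF Quotient3_rp2])
qed

lemma proj_point_surj: obtains v where "v \<noteq> 0" "r = proj_point v"
  using rep_rp2_nonzero proj_point_rep_rp2 by metis

lemma affine_point_lift: "affine_point z = proj_point (lift z)"
  by (simp add: affine_point_def lift_def)

lemma lift_nonzero [simp]: "lift z \<noteq> 0"
  by (metis lift_nth(3) zero_index zero_neq_one)

lemma affine_point_inject: "affine_point z = affine_point w \<longleftrightarrow> z = w"
proof
  assume "affine_point z = affine_point w"
  then obtain k where k: "lift w = k *\<^sub>R lift z"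
    by (auto simp: affine_point_lift proj_point_eq_iff)
  then have "lift w $ 3 = k * lift z $ 3" "lift w $ 1 = k * lift z $ 1"
    "lift w $ 2 = k * lift z $ 2"
    by simp_all
  then show "z = w"
    by (simp add: complex_eq_iff)
qed simp

lemma lift_affine_combination:
  "lift (A + s *\<^sub>R (B - A) + t *\<^sub>R (C - A)) = comb A B C (1 - s - t) s t"
  by (simp add: vec_eq_iff forall_3 comb_def algebra_simps)

lemma affine_point_eq_bary:
  "affine_point (A + s *\<^sub>R (B - A) + t *\<^sub>R (C - A)) = bary A B C (1 - s - t) s t"
  by (simp add: affine_point_lift bary_def lift_affine_combination)

lemma bary_scale:
  assumes "k \<noteq> 0"
  shows "bary A B C (k * x) (k * y) (k * z) = bary A B C x y z"
  using assms by (simp add: bary_def comb_scale proj_point_scale)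

lemma bary_eq_affine_point:
  assumes "x + y + z \<noteq> 0"
  shows "bary A B C x y z =
    affine_point (A + (y / (x + y + z)) *\<^sub>R (B - A) + (z / (x + y + z)) *\<^sub>R (C - A))"
proof -
  define k where "k = x + y + z"
  have "bary A B C x y z = bary A B C (k * (1 - y / k - z / k)) (k * (y / k)) (k * (z / k))"
    using assms by (simp add: k_def[symmetric] right_diff_distrib) (simp add: k_def)
  also have "\<dots> = bary A B C (1 - y / k - z / k) (y / k) (z / k)"
    using assms by (intro bary_scale) (simp add: k_def)
  finally show ?thesis
    by (simp add: affine_point_eq_bary k_def)
qed

section \<open>The triangle and its bisectors in barycentric coordinates\<close>

text \<open>
  Using homogeneous coordinates for subsets of the triangle turns the image under a diagonal map into a
  substitution in the predicate \<open>P\<close>, without any normalisation of the coordinate sum.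
\<close>

definition bary_cone ::
  "complex \<Rightarrow> complex \<Rightarrow> complex \<Rightarrow> (real \<Rightarrow> real \<Rightarrow> real \<Rightarrow> bool) \<Rightarrow> rp2 set" where
  "bary_cone A B C P =
    {bary A B C x y z | x y z. x \<ge> 0 \<and> y \<ge> 0 \<and> z \<ge> 0 \<and> x + y + z > 0 \<and> P x y z}"

lemma bary_in_bary_cone:
  "x \<ge> 0 \<Longrightarrow> y \<ge> 0 \<Longrightarrow> z \<ge> 0 \<Longrightarrow> x + y + z > 0 \<Longrightarrow> P x y z \<Longrightarrow> bary A B C x y z \<in> bary_cone A B C P"
  unfolding bary_cone_def by blast

lemma mem_triangle_region_iff:
  "w \<in> triangle_region A B C \<longleftrightarrow>
    (\<exists>s t. w = A + s *\<^sub>R (B - A) + t *\<^sub>R (C - A) \<and> s \<ge> 0 \<and> t \<ge> 0 \<and> s + t \<le> 1)"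
  unfolding triangle_region_def convex_hull_3_alt by auto

lemma cos_angle:
  assumes "P \<noteq> Q" "R \<noteq> Q"
  shows "cos (angle P Q R) = ((P - Q) \<bullet> (R - Q)) / (norm (P - Q) * norm (R - Q))"
proof -
  define u v where "u = P - Q" and "v = R - Q"
  have nz: "u \<noteq> 0" "v \<noteq> 0"
    using assms by (simp_all add: u_def v_def)
  have "cos (angle P Q R) = Re (u / v) / norm (u / v)"
    using nz by (simp add: angle_def cos_Arg u_def v_def)
  also have "Re (u / v) = (u \<bullet> v) / (norm v)\<^sup>2"
    by (simp add: Re_divide inner_complex_def cmod_power2)
  finally show ?thesis
    using nz by (simp add: norm_divide power2_eq_square field_simps u_def v_def)
qed

lemma angle_eq_iff_cos: "angle P Q R = angle P' Q' R' \<longleftrightarrow> cos (angle P Q R) = cos (angle P' Q' R')"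
proof -
  have "0 \<le> angle X Y Z \<and> angle X Y Z \<le> pi" for X Y Z
    using Arg_bounded[of "(X - Y) / (Z - Y)"] by (auto simp: angle_def)
  then show ?thesis
    by (metis cos_inj_pi)
qed

lemma inner_det2_squares: "(u \<bullet> v)\<^sup>2 + (det2 u v)\<^sup>2 = (norm u * norm v)\<^sup>2"
  by (simp add: inner_complex_def det2_alt power_mult_distrib cmod_power2)
    (simp add: algebra_simps power2_eq_square)

lemma inner_less_norm:
  assumes "det2 u v \<noteq> 0"
  shows "u \<bullet> v < norm u * norm v"
proof (rule power2_less_imp_less)
  have "(det2 u v)\<^sup>2 > 0"
    using assms by simp
  then show "(u \<bullet> v)\<^sup>2 < (norm u * norm v)\<^sup>2"
    using inner_det2_squares[of u v] by linarith
qed simp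

text \<open>
  Both angles are compared through their cosines.  After clearing denominators the equation splits
  into \<open>s \<bar>AB\<bar> = t \<bar>CA\<bar>\<close> and the Cauchy-Schwarz defect of the two sides, which does not vanish because
  they are linearly independent.
\<close>

lemma on_bisector_iff:
  assumes d: "det2 (B - A) (C - A) \<noteq> 0"
    and w: "w = A + s *\<^sub>R (B - A) + t *\<^sub>R (C - A)" "w \<noteq> A"
  shows "angle B A w = angle w A C \<longleftrightarrow> s * norm (B - A) = t * norm (C - A)"
proof -
  define b c u where "b = B - A" and "c = C - A" and "u = w - A"
  have d': "det2 b c \<noteq> 0" and u: "u = s *\<^sub>R b + t *\<^sub>R c" "u \<noteq> 0"
    using d w by (auto simp: b_def c_def u_def)
  have nz: "b \<noteq> 0" "c \<noteq> 0"
    using d' by (auto simp: det2_def)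
  have "angle B A w = angle w A C \<longleftrightarrow>
      (b \<bullet> u) / (norm b * norm u) = (u \<bullet> c) / (norm u * norm c)"
    unfolding angle_eq_iff_cos using w nz by (simp add: cos_angle b_def c_def u_def)
  also have "\<dots> \<longleftrightarrow> (b \<bullet> u) * norm c = (u \<bullet> c) * norm b"
    using nz u(2) by (auto simp: field_simps)
  also have "(b \<bullet> u) * norm c = s * (norm b)\<^sup>2 * norm c + t * (b \<bullet> c) * norm c"
    by (simp add: u inner_right_distrib power2_norm_eq_inner algebra_simps)
  also have "(u \<bullet> c) * norm b = s * (b \<bullet> c) * norm b + t * (norm c)\<^sup>2 * norm b"
    by (simp add: u inner_left_distrib power2_norm_eq_inner algebra_simps)
  also have "s * (norm b)\<^sup>2 * norm c + t * (b \<bullet> c) * norm c =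
      s * (b \<bullet> c) * norm b + t * (norm c)\<^sup>2 * norm b \<longleftrightarrow>
      (s * norm b - t * norm c) * (norm b * norm c - b \<bullet> c) = 0"
    by (auto simp: algebra_simps power2_eq_square)
  also have "\<dots> \<longleftrightarrow> s * norm b = t * norm c"
    using inner_less_norm[OF d'] by simp
  finally show ?thesis
    by (simp add: b_def c_def)
qed

lemma affine_point_triangle_region:
  "affine_point ` triangle_region A B C = bary_cone A B C (\<lambda>x y z. True)"
proof (intro equalityI subsetI)
  fix r assume "r \<in> affine_point ` triangle_region A B C"
  then obtain s t where "r = affine_point (A + s *\<^sub>R (B - A) + t *\<^sub>R (C - A))"
    and st: "s \<ge> 0" "t \<ge> 0" "s + t \<le> 1"
    by (auto simp: mem_triangle_region_iff)
  then have "r = bary A B C (1 - s - t) s t"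
    by (simp add: affine_point_eq_bary)
  with st show "r \<in> bary_cone A B C (\<lambda>x y z. True)"
    by (auto intro: bary_in_bary_cone)
next
  fix r assume "r \<in> bary_cone A B C (\<lambda>x y z. True)"
  then obtain x y z where r: "r = bary A B C x y z"
    and xyz: "x \<ge> 0" "y \<ge> 0" "z \<ge> 0" "x + y + z > 0"
    by (auto simp: bary_cone_def)
  define s t where "s = y / (x + y + z)" and "t = z / (x + y + z)"
  have st: "s \<ge> 0" "t \<ge> 0" "s + t \<le> 1"
    using xyz by (simp_all add: s_def t_def add_divide_distrib[symmetric])
  have "r = affine_point (A + s *\<^sub>R (B - A) + t *\<^sub>R (C - A))"
    using xyz bary_eq_affine_point by (simp add: r s_def t_def)
  moreover have "A + s *\<^sub>R (B - A) + t *\<^sub>R (C - A) \<in> triangle_region A B C"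
    unfolding mem_triangle_region_iff by (rule exI[of _ s], rule exI[of _ t]) (simp add: st)
  ultimately show "r \<in> affine_point ` triangle_region A B C"
    by (rule image_eqI)
qed

lemma affine_point_angle_bisector:
  assumes d: "det2 (B - A) (C - A) \<noteq> 0"
  shows "affine_point ` angle_bisector A B C =
    bary_cone A B C (\<lambda>x y z. y * norm (B - A) = z * norm (C - A))" (is "_ = bary_cone A B C ?P")
proof (intro equalityI subsetI)
  fix r assume "r \<in> affine_point ` angle_bisector A B C"
  then obtain w where w: "w \<in> triangle_region A B C" "w = A \<or> angle B A w = angle w A C"
    and r: "r = affine_point w"
    by (auto simp: angle_bisector_def)
  then obtain s t where w': "w = A + s *\<^sub>R (B - A) + t *\<^sub>R (C - A)"
    and st: "s \<ge> 0" "t \<ge> 0" "s + t \<le> 1"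
    by (auto simp: mem_triangle_region_iff)
  \<comment> \<open>The vertex itself, where no angle is defined, has \<open>s = t = 0\<close>.\<close>
  have "s * norm (B - A) = t * norm (C - A)"
  proof (cases "w = A")
    case True
    have "lift A = comb A B C (1 - s - t) s t"
      using True w' by (metis lift_affine_combination)
    then have "comb A B C 1 0 0 = comb A B C (1 - s - t) s t"
      by (simp add: comb_def)
    then have "s = 0" "t = 0"
      using comb_inject[OF d] by metis+
    then show ?thesis
      by simp
  next
    case False
    then show ?thesis
      using on_bisector_iff[OF d w' False] w by simp
  qed
  moreover have "r = bary A B C (1 - s - t) s t"
    by (simp add: r w' affine_point_eq_bary)
  ultimately show "r \<in> bary_cone A B C ?P"
    using st by (auto intro: bary_in_bary_cone)
next
  fix r assume "r \<in> bary_cone A B C ?P"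
  then obtain x y z where r: "r = bary A B C x y z"
    and xyz: "x \<ge> 0" "y \<ge> 0" "z \<ge> 0" "x + y + z > 0" and P: "?P x y z"
    by (auto simp: bary_cone_def)
  define s t where "s = y / (x + y + z)" and "t = z / (x + y + z)"
  define w where "w = A + s *\<^sub>R (B - A) + t *\<^sub>R (C - A)"
  have "s \<ge> 0" "t \<ge> 0" "s + t \<le> 1"
    using xyz by (auto simp: s_def t_def add_divide_distrib[symmetric])
  then have "w \<in> triangle_region A B C"
    by (auto simp: mem_triangle_region_iff w_def)
  moreover have "s * norm (B - A) = t * norm (C - A)"
    using P by (simp add: s_def t_def field_simps)
  then have "w = A \<or> angle B A w = angle w A C"
    using on_bisector_iff[OF d w_def] by blast
  moreover have "r = affine_point w"
    using xyz unfolding r bary_eq_affine_point[OF less_imp_neq[OF xyz(4), symmetric]]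
    by (simp add: w_def s_def t_def)
  ultimately show "r \<in> affine_point ` angle_bisector A B C"
    by (auto simp: angle_bisector_def)
qed

section \<open>Projective transformations as positive diagonal maps\<close>

text \<open>
  The zero triple has to be excluded since it represents the zero vector, whose class is not a point of the
  projective plane.  Positivity of the weights is part of the notion: it is what makes the map
  send the closed triangle onto the closed triangle.
\<close>

definition diagonal_map ::
  "complex \<Rightarrow> complex \<Rightarrow> complex \<Rightarrow> complex \<Rightarrow> complex \<Rightarrow> complex \<Rightarrow> (rp2 \<Rightarrow> rp2) \<Rightarrow>
    real \<Rightarrow> real \<Rightarrow> real \<Rightarrow> bool" where
  "diagonal_map A B C A' B' C' f \<alpha> \<beta> \<gamma> \<longleftrightarrow> \<alpha> > 0 \<and> \<beta> > 0 \<and> \<gamma> > 0 \<and>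
    (\<forall>x y z. \<not> (x = 0 \<and> y = 0 \<and> z = 0) \<longrightarrow>
      f (bary A B C x y z) = bary A' B' C' (\<alpha> * x) (\<beta> * y) (\<gamma> * z))"

text \<open>Every statement at the vertex \<open>A\<close> is transported to \<open>B\<close> and \<open>C\<close> by relabelling cyclically.\<close>

lemma diagonal_map_rotate:
  "diagonal_map A B C A' B' C' f \<alpha> \<beta> \<gamma> \<Longrightarrow> diagonal_map B C A B' C' A' f \<beta> \<gamma> \<alpha>"
  unfolding diagonal_map_def by (metis bary_rotate)

lemma diagonal_map_pos:
  assumes "diagonal_map A B C A' B' C' f \<alpha> \<beta> \<gamma>"
  shows "\<alpha> > 0" "\<beta> > 0" "\<gamma> > 0"
  using assms by (simp_all add: diagonal_map_def)

lemma diagonal_map_bary: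
  assumes "diagonal_map A B C A' B' C' f \<alpha> \<beta> \<gamma>" "\<not> (x = 0 \<and> y = 0 \<and> z = 0)"
  shows "f (bary A B C x y z) = bary A' B' C' (\<alpha> * x) (\<beta> * y) (\<gamma> * z)"
  using assms unfolding diagonal_map_def by blast

lemma weighted_sum_pos:
  fixes \<alpha> \<beta> \<gamma> x y z :: real
  assumes "\<alpha> > 0" "\<beta> > 0" "\<gamma> > 0" "x \<ge> 0" "y \<ge> 0" "z \<ge> 0" "x + y + z > 0"
  shows "\<alpha> * x + \<beta> * y + \<gamma> * z > 0"
proof -
  have "x > 0 \<or> y > 0 \<or> z > 0"
    using assms by linarith
  then have "\<alpha> * x > 0 \<or> \<beta> * y > 0 \<or> \<gamma> * z > 0"
    using assms by (metis mult_pos_pos)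
  moreover have "\<alpha> * x \<ge> 0" "\<beta> * y \<ge> 0" "\<gamma> * z \<ge> 0"
    using assms by simp_all
  ultimately show ?thesis
    by linarith
qed

lemma diagonal_map_image_bary_cone:
  assumes f: "diagonal_map A B C A' B' C' f \<alpha> \<beta> \<gamma>"
    and P: "\<And>x y z. P x y z \<longleftrightarrow> P' (\<alpha> * x) (\<beta> * y) (\<gamma> * z)"
  shows "f ` bary_cone A B C P = bary_cone A' B' C' P'"
proof (intro equalityI subsetI)
  note pos = diagonal_map_pos[OF f]
  {
    fix r assume "r \<in> f ` bary_cone A B C P"
    then obtain x y z where r: "r = f (bary A B C x y z)"
      and xyz: "x \<ge> 0" "y \<ge> 0" "z \<ge> 0" "x + y + z > 0" "P x y z"
      unfolding bary_cone_def by blast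
    have "\<not> (x = 0 \<and> y = 0 \<and> z = 0)"
      using xyz(4) by auto
    then have "r = bary A' B' C' (\<alpha> * x) (\<beta> * y) (\<gamma> * z)"
      using diagonal_map_bary[OF f] r by simp
    moreover have "\<alpha> * x \<ge> 0" "\<beta> * y \<ge> 0" "\<gamma> * z \<ge> 0"
      using xyz pos by simp_all
    moreover have "P' (\<alpha> * x) (\<beta> * y) (\<gamma> * z)"
      using xyz(5) P by blast
    ultimately show "r \<in> bary_cone A' B' C' P'"
      using weighted_sum_pos[OF pos xyz(1-4)] bary_in_bary_cone by metis
  next
    fix r assume "r \<in> bary_cone A' B' C' P'"
    then obtain x y z where r: "r = bary A' B' C' x y z"
      and xyz: "x \<ge> 0" "y \<ge> 0" "z \<ge> 0" "x + y + z > 0" "P' x y z"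
      unfolding bary_cone_def by blast
    define x1 y1 z1 where "x1 = x / \<alpha>" and "y1 = y / \<beta>" and "z1 = z / \<gamma>"
    have eqs: "\<alpha> * x1 = x" "\<beta> * y1 = y" "\<gamma> * z1 = z"
      using pos by (simp_all add: x1_def y1_def z1_def)
    have nonneg: "x1 \<ge> 0" "y1 \<ge> 0" "z1 \<ge> 0"
      using xyz pos by (simp_all add: x1_def y1_def z1_def)
    have nz: "\<not> (x1 = 0 \<and> y1 = 0 \<and> z1 = 0)"
      using xyz(4) by (auto simp flip: eqs)
    with nonneg have "x1 + y1 + z1 > 0"
      by linarith
    then have "bary A B C x1 y1 z1 \<in> bary_cone A B C P"
      using nonneg xyz(5) P eqs by (intro bary_in_bary_cone) simp_all
    moreover have "r = f (bary A B C x1 y1 z1)"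
      using diagonal_map_bary[OF f nz] r eqs by simp
    ultimately show "r \<in> f ` bary_cone A B C P"
      by blast
  }
qed

lemma diagonal_map_image_triangle_region:
  assumes "diagonal_map A B C A' B' C' f \<alpha> \<beta> \<gamma>"
  shows "f ` affine_point ` triangle_region A B C = affine_point ` triangle_region A' B' C'"
  unfolding affine_point_triangle_region by (rule diagonal_map_image_bary_cone[OF assms]) simp

text \<open>
  For the forward direction it is enough to follow one point, the foot \<open>0 : \<bar>CA\<bar> : \<bar>AB\<bar>\<close> of the bisector
  on the side opposite to \<open>A\<close>: its image \<open>0 : \<beta> \<bar>CA\<bar> : \<gamma> \<bar>AB\<bar>\<close> must lie on the other bisector.
\<close>

lemma diagonal_map_bisector_iff:
  assumes f: "diagonal_map A B C A' B' C' f \<alpha> \<beta> \<gamma>"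
    and d: "det2 (B - A) (C - A) \<noteq> 0" and d': "det2 (B' - A') (C' - A') \<noteq> 0"
  shows "f ` affine_point ` angle_bisector A B C = affine_point ` angle_bisector A' B' C' \<longleftrightarrow>
    \<beta> * norm (C - A) * norm (B' - A') = \<gamma> * norm (B - A) * norm (C' - A')"
  unfolding affine_point_angle_bisector[OF d] affine_point_angle_bisector[OF d']
proof
  note pos = diagonal_map_pos[OF f]
  have nz: "norm (B - A) > 0" "norm (C - A) > 0" "norm (B' - A') > 0" "norm (C' - A') > 0"
    using d d' by (auto simp: det2_def)
  let ?P = "\<lambda>x y z. y * norm (B - A) = z * norm (C - A)"
  let ?P' = "\<lambda>x y z. y * norm (B' - A') = z * norm (C' - A')"
  {
    assume eq: "f ` bary_cone A B C ?P = bary_cone A' B' C' ?P'"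
    let ?y = "norm (C - A)" and ?z = "norm (B - A)"
    have "bary A B C 0 ?y ?z \<in> bary_cone A B C ?P"
      by (rule bary_in_bary_cone) (use nz in \<open>simp_all add: add_pos_pos del: zero_less_norm_iff\<close>)
    then have "f (bary A B C 0 ?y ?z) \<in> bary_cone A' B' C' ?P'"
      using eq by blast
    moreover have "f (bary A B C 0 ?y ?z) = bary A' B' C' (\<alpha> * 0) (\<beta> * ?y) (\<gamma> * ?z)"
      using nz by (intro diagonal_map_bary[OF f]) auto
    ultimately have "bary A' B' C' (\<alpha> * 0) (\<beta> * ?y) (\<gamma> * ?z) \<in> bary_cone A' B' C' ?P'"
      by (simp only:)
    then obtain x y z where
      xyz: "bary A' B' C' (\<alpha> * 0) (\<beta> * ?y) (\<gamma> * ?z) = bary A' B' C' x y z"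
      "x + y + z > 0" "?P' x y z"
      unfolding bary_cone_def by blast
    have "comb A' B' C' (\<alpha> * 0) (\<beta> * ?y) (\<gamma> * ?z) \<noteq> 0" "comb A' B' C' x y z \<noteq> 0"
      using xyz(2) nz pos by (auto simp: comb_eq_0_iff[OF d'])
    then obtain k where
      "comb A' B' C' (\<alpha> * 0) (\<beta> * ?y) (\<gamma> * ?z) = k *\<^sub>R comb A' B' C' x y z"
      using xyz(1) unfolding bary_def by (metis proj_point_eq_iff)
    then have "\<beta> * ?y = k * y" "\<gamma> * ?z = k * z"
      unfolding comb_scale[symmetric] using comb_inject[OF d'] by metis+
    then show "\<beta> * norm (C - A) * norm (B' - A') = \<gamma> * norm (B - A) * norm (C' - A')"
      using xyz(3) by (simp add: mult.assoc)
  next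
    assume eq: "\<beta> * norm (C - A) * norm (B' - A') = \<gamma> * norm (B - A) * norm (C' - A')"
    show "f ` bary_cone A B C ?P = bary_cone A' B' C' ?P'"
    proof (rule diagonal_map_image_bary_cone[OF f])
      fix x y z :: real
      define p q where "p = \<beta> * norm (B' - A')" and "q = \<gamma> * norm (C' - A')"
      have pq: "p * norm (C - A) = q * norm (B - A)" "q > 0"
        using eq pos nz by (auto simp: p_def q_def algebra_simps)
      have "y * p = z * q \<longleftrightarrow> y * (p * norm (C - A)) = z * q * norm (C - A)"
        using nz by simp
      also have "\<dots> \<longleftrightarrow> q * (y * norm (B - A)) = q * (z * norm (C - A))"
        unfolding pq(1) by (simp add: mult_ac)
      also have "\<dots> \<longleftrightarrow> y * norm (B - A) = z * norm (C - A)"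
        using pq by simp
      finally show "y * norm (B - A) = z * norm (C - A) \<longleftrightarrow>
          \<beta> * y * norm (B' - A') = \<gamma> * z * norm (C' - A')"
        by (simp add: p_def q_def mult_ac)
    qed
  }
qed

text \<open>
  The matrix maps the lifted vertices to multiples of the lifted vertices, which yields the weights.
  They have the same sign because no point of the triangle may go to the line at infinity; if, say,
  \<open>\<alpha>\<close> and \<open>\<beta>\<close> had opposite signs, the point \<open>\<bar>\<beta>\<bar> : \<bar>\<alpha>\<bar> : 0\<close> on the side \<open>AB\<close> would go there.
\<close>

lemma maps_triangle_imp_diagonal_map:
  assumes m: "maps_triangle A B C A' B' C' g"
    and d: "det2 (B - A) (C - A) \<noteq> 0"
  obtains \<alpha> \<beta> \<gamma> where "diagonal_map A B C A' B' C' g \<alpha> \<beta> \<gamma>"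
proof -
  obtain M :: "real^3^3" where M: "invertible M"
    and g: "\<And>v. v \<noteq> 0 \<Longrightarrow> g (proj_point v) = proj_point (M *v v)"
    using m by (auto simp: maps_triangle_def projective_transformation_def)
  have Mnz: "M *v v \<noteq> 0" if "v \<noteq> 0" for v
    using M that
    by (metis matrix_inv_mult(1) matrix_vector_mul_assoc matrix_vector_mul_lid matrix_vector_mult_0_right)
  have vertex: "\<exists>k. M *v lift Q = k *\<^sub>R lift Q'" if "g (affine_point Q) = affine_point Q'" for Q Q'
    using that g[OF lift_nonzero, of Q] Mnz[OF lift_nonzero, of Q]
    unfolding affine_point_lift by (metis lift_nonzero proj_point_eq_iff)
  from m obtain \<alpha> \<beta> \<gamma> where
    vert: "M *v lift A = \<alpha> *\<^sub>R lift A'" "M *v lift B = \<beta> *\<^sub>R lift B'" "M *v lift C = \<gamma> *\<^sub>R lift C'"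
    unfolding maps_triangle_def by (metis vertex)
  have M_comb: "M *v comb A B C x y z = comb A' B' C' (\<alpha> * x) (\<beta> * y) (\<gamma> * z)" for x y z
    by (simp add: comb_def matrix_vector_right_distrib vec.scale vert scalar_mult_eq_scaleR
        matrix_vector_mult_scaleR mult_ac)
  have g_bary: "g (bary A B C x y z) = bary A' B' C' (\<alpha> * x) (\<beta> * y) (\<gamma> * z)"
    if "\<not> (x = 0 \<and> y = 0 \<and> z = 0)" for x y z
    using g that M_comb comb_eq_0_iff[OF d] by (auto simp: bary_def)
  have finite_image: "\<alpha> * x + \<beta> * y + \<gamma> * z \<noteq> 0"
    if "x \<ge> 0" "y \<ge> 0" "z \<ge> 0" "x + y + z > 0" for x y z
  proof
    assume 0: "\<alpha> * x + \<beta> * y + \<gamma> * z = 0"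
    have "bary A B C x y z \<in> affine_point ` triangle_region A B C"
      unfolding affine_point_triangle_region by (rule bary_in_bary_cone) (use that in simp_all)
    then have "g (bary A B C x y z) \<in> affine_point ` triangle_region A' B' C'"
      using m unfolding maps_triangle_def by blast
    then obtain w where w: "g (bary A B C x y z) = proj_point (lift w)"
      by (auto simp: affine_point_lift)
    have "comb A B C x y z \<noteq> 0"
      using that comb_eq_0_iff[OF d] by auto
    then have "g (bary A B C x y z) = proj_point (M *v comb A B C x y z)"
      "M *v comb A B C x y z \<noteq> 0"
      using g Mnz by (auto simp: bary_def)
    then obtain k where "lift w = k *\<^sub>R (M *v comb A B C x y z)"
      using w proj_point_eq_iff by (metis lift_nonzero)
    then have "lift w = k *\<^sub>R comb A' B' C' (\<alpha> * x) (\<beta> * y) (\<gamma> * z)"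
      by (simp add: M_comb)
    then have "lift w $ 3 = k * (\<alpha> * x + \<beta> * y + \<gamma> * z)"
      by (simp add: comb_def)
    then show False
      using 0 by simp
  qed
  have nz: "\<alpha> \<noteq> 0" "\<beta> \<noteq> 0" "\<gamma> \<noteq> 0"
    using finite_image[of 1 0 0] finite_image[of 0 1 0] finite_image[of 0 0 1] by auto
  have same_sign: "\<alpha> * \<beta> > 0" "\<alpha> * \<gamma> > 0"
  proof -
    have "\<alpha> * \<bar>\<beta>\<bar> + \<beta> * \<bar>\<alpha>\<bar> \<noteq> 0" "\<alpha> * \<bar>\<gamma>\<bar> + \<gamma> * \<bar>\<alpha>\<bar> \<noteq> 0"
      using finite_image[of "\<bar>\<beta>\<bar>" "\<bar>\<alpha>\<bar>" 0] finite_image[of "\<bar>\<gamma>\<bar>" 0 "\<bar>\<alpha>\<bar>"] nz by auto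
    then show "\<alpha> * \<beta> > 0" "\<alpha> * \<gamma> > 0"
      using nz by (auto simp: zero_less_mult_iff abs_if split: if_splits)
  qed
  \<comment> \<open>Dividing by \<open>\<alpha>\<close> makes all weights positive without changing the point map.\<close>
  show thesis
  proof (rule that[of "\<alpha> / \<alpha>" "\<beta> / \<alpha>" "\<gamma> / \<alpha>"])
    have "bary A' B' C' (\<alpha> * x) (\<beta> * y) (\<gamma> * z) =
        bary A' B' C' (\<alpha> / \<alpha> * x) (\<beta> / \<alpha> * y) (\<gamma> / \<alpha> * z)" for x y z
      using bary_scale[of \<alpha> A' B' C' "\<alpha> / \<alpha> * x" "\<beta> / \<alpha> * y" "\<gamma> / \<alpha> * z"] nz by simp
    then show "diagonal_map A B C A' B' C' g (\<alpha> / \<alpha>) (\<beta> / \<alpha>) (\<gamma> / \<alpha>)"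
      using g_bary same_sign nz
      by (auto simp: diagonal_map_def zero_less_mult_iff zero_less_divide_iff)
  qed
qed

lemma diagonal_map_imp_maps_triangle:
  assumes "projective_transformation f" and f: "diagonal_map A B C A' B' C' f \<alpha> \<beta> \<gamma>"
  shows "maps_triangle A B C A' B' C' f"
proof -
  have vertex: "bary P Q R k 0 0 = affine_point P" if "k \<noteq> 0" for P Q R k
    using that bary_eq_affine_point[of k 0 0 P Q R] by simp
  have A: "f (affine_point A) = affine_point A'"
    if f: "diagonal_map A B C A' B' C' f \<alpha> \<beta> \<gamma>" for A B C A' B' C' \<alpha> \<beta> \<gamma>
  proof -
    have "f (affine_point A) = f (bary A B C 1 0 0)"
      by (simp add: vertex)
    also have "\<dots> = bary A' B' C' \<alpha> 0 0"
      using diagonal_map_bary[OF f, of 1 0 0] by simp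
    also have "\<dots> = affine_point A'"
      using diagonal_map_pos[OF f] by (simp add: vertex)
    finally show ?thesis .
  qed
  note f2 = diagonal_map_rotate[OF f]
  note f3 = diagonal_map_rotate[OF f2]
  show ?thesis
    unfolding maps_triangle_def
    using assms(1) A[OF f] A[OF f2] A[OF f3] diagonal_map_image_triangle_region[OF f]
    by (intro conjI)
qed

text \<open>
  In barycentric coordinates the map is a diagonal matrix; conjugating with the coordinate changes of
  the two triangles gives the matrix of the projective transformation.
\<close>

lemma diagonal_map_exists:
  assumes d: "det2 (B - A) (C - A) \<noteq> 0" and d': "det2 (B' - A') (C' - A') \<noteq> 0"
    and pos: "\<alpha> > 0" "\<beta> > 0" "\<gamma> > 0"
  obtains f where "projective_transformation f" "diagonal_map A B C A' B' C' f \<alpha> \<beta> \<gamma>"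
proof -
  let ?N = "comb_matrix A B C" and ?N' = "comb_matrix A' B' C'"
  define E :: "real^3^3" where
    "E = vector [vector [\<alpha>, 0, 0], vector [0, \<beta>, 0], vector [0, 0, \<gamma>]]"
  define M where "M = ?N' ** E ** matrix_inv ?N"
  define f where "f r = proj_point (M *v rep_rp2 r)" for r
  have "invertible E"
    using pos by (simp add: invertible_det_nz det_3 E_def)
  moreover have "invertible (matrix_inv ?N)"
    using matrix_inv_mult[OF invertible_comb_matrix[OF d]] unfolding invertible_def by blast
  ultimately have inv: "invertible M"
    unfolding M_def by (intro invertible_mult invertible_comb_matrix d')
  have f: "f (proj_point v) = proj_point (M *v v)" if "v \<noteq> 0" for v
  proof -
    have "\<exists>k. rep_rp2 (proj_point v) = k *\<^sub>R v"
      using proj_point_eq_iff[OF that rep_rp2_nonzero[of "proj_point v"]] proj_point_rep_rp2[of "proj_point v"]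
      by simp
    then obtain k where k: "rep_rp2 (proj_point v) = k *\<^sub>R v" ..
    then have "k \<noteq> 0"
      using rep_rp2_nonzero[of "proj_point v"] by auto
    then show ?thesis
      by (simp add: f_def k matrix_vector_mult_scaleR proj_point_scale)
  qed
  have E: "E *v v = vector [\<alpha> * v $ 1, \<beta> * v $ 2, \<gamma> * v $ 3]" for v
    by (simp add: E_def vec_eq_iff forall_3 matrix_vector_mult_def sum_3)
  have M: "M *v comb A B C x y z = comb A' B' C' (\<alpha> * x) (\<beta> * y) (\<gamma> * z)" for x y z
  proof -
    have "comb A B C x y z = ?N *v vector [x, y, z]"
      by (simp add: comb_matrix_mult)
    then have "M *v comb A B C x y z = (?N' ** E ** (matrix_inv ?N ** ?N)) *v vector [x, y, z]"
      by (simp add: M_def matrix_vector_mul_assoc matrix_mul_assoc)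
    also have "\<dots> = ?N' *v (E *v vector [x, y, z])"
      by (simp add: matrix_inv_mult(1)[OF invertible_comb_matrix[OF d]] matrix_vector_mul_assoc)
    finally show ?thesis
      by (simp add: E comb_matrix_mult)
  qed
  show thesis
  proof
    show "projective_transformation f"
      using inv f by (auto simp: projective_transformation_def)
    show "diagonal_map A B C A' B' C' f \<alpha> \<beta> \<gamma>"
      using pos f M comb_eq_0_iff[OF d] by (auto simp: diagonal_map_def bary_def)
  qed
qed

lemma diagonal_map_unique:
  assumes d: "det2 (B - A) (C - A) \<noteq> 0"
    and f: "diagonal_map A B C A' B' C' f \<alpha> \<beta> \<gamma>"
    and g: "diagonal_map A B C A' B' C' g (k * \<alpha>) (k * \<beta>) (k * \<gamma>)"
  shows "f = g"
proof
  fix r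
  obtain v where v: "v \<noteq> 0" "r = proj_point v"
    by (rule proj_point_surj)
  obtain x y z where xyz: "v = comb A B C x y z"
    using comb_surj[OF d] .
  have nz: "\<not> (x = 0 \<and> y = 0 \<and> z = 0)"
    using v xyz by auto
  have "k \<noteq> 0"
    using g by (auto simp: diagonal_map_def)
  have "g r = bary A' B' C' (k * (\<alpha> * x)) (k * (\<beta> * y)) (k * (\<gamma> * z))"
    using diagonal_map_bary[OF g nz] by (simp add: v xyz bary_def mult.assoc)
  also have "\<dots> = f r"
    using diagonal_map_bary[OF f nz] by (simp add: v xyz bary_def[symmetric] bary_scale[OF \<open>k \<noteq> 0\<close>])
  finally show "f r = g r" ..
qed

section \<open>The derivative in the affine chart\<close>

text \<open>The first coordinate of \<open>h\<close> in the basis \<open>b, c\<close> by Cramer's rule; the second one is \<open>coord c b h\<close>.\<close>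

definition coord :: "complex \<Rightarrow> complex \<Rightarrow> complex \<Rightarrow> real" where
  "coord b c h = det2 h c / det2 b c"

lemma coord_decomposition:
  assumes "det2 b c \<noteq> 0"
  shows "h = coord b c h *\<^sub>R b + coord c b h *\<^sub>R c"
proof -
  have "det2 c b = - det2 b c"
    by (simp add: det2_alt)
  moreover have "det2 b c *\<^sub>R h = det2 h c *\<^sub>R b - det2 h b *\<^sub>R c"
    by (simp add: complex_eq_iff det2_alt algebra_simps)
  then have "h = (1 / det2 b c) *\<^sub>R (det2 h c *\<^sub>R b - det2 h b *\<^sub>R c)"
    using assms by (metis divide_self_if scaleR_scaleR scaleR_one times_divide_eq_left mult_1)
  ultimately show ?thesis
    by (simp add: coord_def scaleR_diff_right)
qed

lemma bounded_linear_coord: "bounded_linear (coord b c)"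
  unfolding linear_conv_bounded_linear[symmetric]
  by (rule linearI)
    (simp_all add: coord_def det2_alt algebra_simps add_divide_distrib diff_divide_distrib)

lemma in_chart_diagonal_map:
  fixes A B C A' B' C' z :: complex and \<alpha> \<beta> \<gamma> :: real
  defines "b \<equiv> B - A" and "c \<equiv> C - A" and "b' \<equiv> B' - A'" and "c' \<equiv> C' - A'"
  defines "s \<equiv> coord b c (z - A)" and "t \<equiv> coord c b (z - A)"
  defines "D \<equiv> \<alpha> * (1 - s - t) + \<beta> * s + \<gamma> * t"
  assumes f: "diagonal_map A B C A' B' C' f \<alpha> \<beta> \<gamma>"
    and d: "det2 b c \<noteq> 0" and D: "D \<noteq> 0"
  shows "in_chart f z = A' + (\<beta> * s / D) *\<^sub>R b' + (\<gamma> * t / D) *\<^sub>R c'"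
proof -
  have "z - A = s *\<^sub>R b + t *\<^sub>R c"
    unfolding s_def t_def by (rule coord_decomposition[OF d])
  then have "z = A + s *\<^sub>R (B - A) + t *\<^sub>R (C - A)"
    by (simp add: b_def c_def algebra_simps)
  then have "affine_point z = bary A B C (1 - s - t) s t"
    using affine_point_eq_bary by metis
  then have "f (affine_point z) = bary A' B' C' (\<alpha> * (1 - s - t)) (\<beta> * s) (\<gamma> * t)"
    by (simp add: diagonal_map_bary[OF f])
  also have "\<dots> = affine_point (A' + (\<beta> * s / D) *\<^sub>R b' + (\<gamma> * t / D) *\<^sub>R c')"
    using bary_eq_affine_point[OF D[unfolded D_def]] by (simp add: D_def b'_def c'_def)
  finally show ?thesis
    by (simp add: in_chart_def affine_point_inject)
qed

text \<open>
  The fractional linear expression for the map holds wherever its denominator \<open>N\<close> is nonzero.  This is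
  an open set, so differentiating the expression by the quotient rule gives the derivative.  Here \<open>E\<close> is
  the derivative of \<open>N\<close>.
\<close>

lemma has_derivative_in_chart_diagonal_map:
  fixes A B C A' B' C' z :: complex and \<alpha> \<beta> \<gamma> :: real
  defines "b \<equiv> B - A" and "c \<equiv> C - A" and "b' \<equiv> B' - A'" and "c' \<equiv> C' - A'"
  defines "s \<equiv> coord b c (z - A)" and "t \<equiv> coord c b (z - A)"
  defines "D \<equiv> \<alpha> * (1 - s - t) + \<beta> * s + \<gamma> * t"
  defines "E \<equiv> \<lambda>h. (\<beta> - \<alpha>) * coord b c h + (\<gamma> - \<alpha>) * coord c b h"
  assumes f: "diagonal_map A B C A' B' C' f \<alpha> \<beta> \<gamma>"
    and d: "det2 b c \<noteq> 0" and D: "D \<noteq> 0"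
  shows "(in_chart f has_derivative
    (\<lambda>h. (\<beta> * (coord b c h * D - s * E h) / D\<^sup>2) *\<^sub>R b' +
         (\<gamma> * (coord c b h * D - t * E h) / D\<^sup>2) *\<^sub>R c')) (at z)"
proof -
  define S T where "S w = coord b c (w - A)" and "T w = coord c b (w - A)" for w
  define N where "N w = \<alpha> * (1 - S w - T w) + \<beta> * S w + \<gamma> * T w" for w
  have S: "(S has_derivative coord b c) (at w)" and T: "(T has_derivative coord c b) (at w)" for w
    unfolding S_def[abs_def] T_def[abs_def]
    by (rule bounded_linear.has_derivative[OF bounded_linear_coord], auto intro!: derivative_eq_intros)+
  have N: "(N has_derivative E) (at w)" for w
    unfolding N_def[abs_def] E_def
    by (rule derivative_eq_intros S T refl | simp add: fun_eq_iff algebra_simps)+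
  have at_z: "S z = s" "T z = t" "N z = D"
    by (simp_all add: S_def T_def N_def s_def t_def D_def)
  have quotient: "((\<lambda>w. k * U w / N w) has_derivative (\<lambda>h. k * (U' h * D - U z * E h) / D\<^sup>2)) (at z)"
    if "(U has_derivative U') (at z)" for U :: "complex \<Rightarrow> real" and U' k
    using D
    by (auto intro!: derivative_eq_intros that N
        simp: at_z fun_eq_iff power2_eq_square algebra_simps)
  have "((\<lambda>w. A' + (\<beta> * S w / N w) *\<^sub>R b' + (\<gamma> * T w / N w) *\<^sub>R c') has_derivative
      (\<lambda>h. (\<beta> * (coord b c h * D - s * E h) / D\<^sup>2) *\<^sub>R b' +
           (\<gamma> * (coord c b h * D - t * E h) / D\<^sup>2) *\<^sub>R c')) (at z)"
    using has_derivative_add[OF has_derivative_add[OF has_derivative_const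
          has_derivative_scaleR_left[OF quotient[OF S]]] has_derivative_scaleR_left[OF quotient[OF T]]]
    unfolding at_z by simp
  moreover have "open {w. N w \<noteq> 0}"
    using N has_derivative_continuous
    by (intro open_Collect_neq)
      (blast intro: continuous_at_imp_continuous_on continuous_on_const)+
  moreover have "z \<in> {w. N w \<noteq> 0}"
    using D at_z by simp
  moreover have "A' + (\<beta> * S w / N w) *\<^sub>R b' + (\<gamma> * T w / N w) *\<^sub>R c' = in_chart f w"
    if "w \<in> {w. N w \<noteq> 0}" for w
    using that in_chart_diagonal_map[OF f d[unfolded b_def c_def], of w]
    by (simp add: N_def S_def T_def b_def c_def b'_def c'_def)
  ultimately show ?thesis
    by (rule has_derivative_transform_within_open)
qed

lemma det2_linear_combination:
  "det2 (x1 *\<^sub>R u + y1 *\<^sub>R v) (x2 *\<^sub>R u + y2 *\<^sub>R v) = (x1 * y2 - y1 * x2) * det2 u v"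
  by (simp add: det2_alt algebra_simps)

lemma coord_jacobian:
  assumes "det2 b c \<noteq> 0"
  shows "coord b c 1 * coord c b \<i> - coord c b 1 * coord b c \<i> = 1 / det2 b c"
proof -
  have "det2 1 \<i> = 1"
    by (simp add: det2_alt)
  moreover have "det2 1 \<i> = (coord b c 1 * coord c b \<i> - coord c b 1 * coord b c \<i>) * det2 b c"
    using det2_linear_combination coord_decomposition[OF assms] by metis
  ultimately show ?thesis
    using assms by (simp add: field_simps)
qed

text \<open>
  The Jacobian determinant is \<open>\<alpha> \<beta> \<gamma> / D\<^sup>3\<close> times the ratio of the signed areas of the triangles; the
  denominator \<open>D\<close> is a combination of positive weights with the barycentric coordinates of \<open>z\<close>, which
  are nonnegative with sum 1.
\<close>

lemma orientation_preserving_diagonal_map: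
  assumes f: "diagonal_map A B C A' B' C' f \<alpha> \<beta> \<gamma>"
    and same: "det2 (B - A) (C - A) * det2 (B' - A') (C' - A') > 0"
    and z: "z \<in> triangle_region A B C"
  shows "orientation_preserving_at (in_chart f) z"
proof -
  define b c b' c' where "b = B - A" and "c = C - A" and "b' = B' - A'" and "c' = C' - A'"
  define s t where "s = coord b c (z - A)" and "t = coord c b (z - A)"
  define D where "D = \<alpha> * (1 - s - t) + \<beta> * s + \<gamma> * t"
  define E where "E h = (\<beta> - \<alpha>) * coord b c h + (\<gamma> - \<alpha>) * coord c b h" for h
  have pos: "\<alpha> > 0" "\<beta> > 0" "\<gamma> > 0"
    using diagonal_map_pos[OF f] .
  have d: "det2 b c \<noteq> 0" "det2 b c * det2 b' c' > 0"
    using same by (auto simp: b_def c_def b'_def c'_def)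
  obtain s' t' where z': "z = A + s' *\<^sub>R b + t' *\<^sub>R c" and st': "s' \<ge> 0" "t' \<ge> 0" "s' + t' \<le> 1"
    using z by (auto simp: mem_triangle_region_iff b_def c_def)
  have "det2 c b = - det2 b c"
    by (simp add: det2_alt)
  moreover have "det2 (z - A) c = s' * det2 b c" "det2 (z - A) b = t' * det2 c b"
    by (simp_all add: z' det2_alt algebra_simps)
  ultimately have "s = s'" "t = t'"
    using d by (simp_all add: s_def t_def coord_def)
  with st' have st: "1 - s - t \<ge> 0" "s \<ge> 0" "t \<ge> 0"
    by auto
  have "D > 0"
    unfolding D_def using pos st by (intro weighted_sum_pos) simp_all
  define x y where "x h = \<beta> * (coord b c h * D - s * E h) / D\<^sup>2"
    and "y h = \<gamma> * (coord c b h * D - t * E h) / D\<^sup>2" for h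
  have der: "(in_chart f has_derivative (\<lambda>h. x h *\<^sub>R b' + y h *\<^sub>R c')) (at z)"
    using has_derivative_in_chart_diagonal_map[OF f d(1)[unfolded b_def c_def], of z] \<open>D > 0\<close>
    unfolding x_def y_def E_def D_def s_def t_def b_def c_def b'_def c'_def by simp
  have "partial_x (in_chart f) z = x 1 *\<^sub>R b' + y 1 *\<^sub>R c'"
    "partial_y (in_chart f) z = x \<i> *\<^sub>R b' + y \<i> *\<^sub>R c'"
    unfolding partial_x_def partial_y_def frechet_derivative_at[OF der, symmetric] by simp_all
  then have "Im (cnj (partial_x (in_chart f) z) * partial_y (in_chart f) z) =
      (x 1 * y \<i> - y 1 * x \<i>) * det2 b' c'"
    unfolding det2_def[symmetric] by (simp only: det2_linear_combination)
  also have "x 1 * y \<i> - y 1 * x \<i> = \<alpha> * \<beta> * \<gamma> / D ^ 3 / det2 b c"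
  proof -
    define u1 v1 u2 v2 where "u1 = coord b c 1" and "v1 = coord c b 1"
      and "u2 = coord b c \<i>" and "v2 = coord c b \<i>"
    define W where "W = u1 * v2 - v1 * u2"
    have W: "W = 1 / det2 b c"
      using coord_jacobian[OF d(1)] by (simp add: W_def u1_def u2_def v1_def v2_def)
    have "(u1 * D - s * E 1) * (v2 * D - t * E \<i>) - (v1 * D - t * E 1) * (u2 * D - s * E \<i>) =
        D * W * (D - s * (\<beta> - \<alpha>) - t * (\<gamma> - \<alpha>))"
      unfolding W_def E_def u1_def[symmetric] u2_def[symmetric] v1_def[symmetric] v2_def[symmetric]
      by algebra
    also have "D - s * (\<beta> - \<alpha>) - t * (\<gamma> - \<alpha>) = \<alpha>"
      by (simp add: D_def algebra_simps)
    finally have "(u1 * D - s * E 1) * (v2 * D - t * E \<i>) - (v1 * D - t * E 1) * (u2 * D - s * E \<i>) =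
        D * W * \<alpha>" .
    moreover have "x 1 * y \<i> - y 1 * x \<i> = \<beta> * \<gamma> *
        ((u1 * D - s * E 1) * (v2 * D - t * E \<i>) - (v1 * D - t * E 1) * (u2 * D - s * E \<i>)) / D ^ 4"
      using \<open>D > 0\<close>
      by (simp add: x_def y_def u1_def u2_def v1_def v2_def field_simps power_numeral_reduce)
    ultimately show ?thesis
      using \<open>D > 0\<close> by (simp add: W power_numeral_reduce mult_ac)
  qed
  also have "\<alpha> * \<beta> * \<gamma> / D ^ 3 / det2 b c * det2 b' c' > 0"
  proof -
    have "det2 b' c' / det2 b c > 0"
      using d(2) by (auto simp: zero_less_mult_iff zero_less_divide_iff)
    moreover have "\<alpha> * \<beta> * \<gamma> / D ^ 3 > 0"
      using pos \<open>D > 0\<close> by simp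
    ultimately have "\<alpha> * \<beta> * \<gamma> / D ^ 3 * (det2 b' c' / det2 b c) > 0"
      by (rule mult_pos_pos[rotated])
    then show ?thesis
      by simp
  qed
  finally show ?thesis
    using der by (auto simp: orientation_preserving_at_def differentiable_def)
qed

section \<open>The eccentricity at a vertex\<close>

lemma coord_wirtinger:
  "of_real (coord b c 1) - \<i> * of_real (coord b c \<i>) = \<i> * cnj c / of_real (det2 b c)"
  "of_real (coord b c 1) + \<i> * of_real (coord b c \<i>) = - \<i> * c / of_real (det2 b c)"
  by (simp_all add: coord_def complex_eq_iff) (simp_all add: det2_alt)

text \<open>
  At \<open>A\<close> the denominator equals \<open>\<alpha>\<close> and the derivative is \<open>B - A \<mapsto> (\<beta> / \<alpha>) (B' - A')\<close>,
  \<open>C - A \<mapsto> (\<gamma> / \<alpha>) (C' - A')\<close>.  The common factor \<open>k\<close> cancels in the modulus of the Beltrami coefficient,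
  which therefore depends on the weights only through the ratio of \<open>\<beta>\<close> and \<open>\<gamma>\<close>.
\<close>

lemma wirtinger_diagonal_map:
  fixes A B C A' B' C' :: complex and \<alpha> \<beta> \<gamma> :: real
  defines "b \<equiv> B - A" and "c \<equiv> C - A" and "b' \<equiv> B' - A'" and "c' \<equiv> C' - A'"
  assumes f: "diagonal_map A B C A' B' C' f \<alpha> \<beta> \<gamma>" and d: "det2 b c \<noteq> 0"
  defines "k \<equiv> \<i> / of_real (2 * \<alpha> * det2 b c)"
  shows "wirtinger_z (in_chart f) A = k * (of_real \<beta> * b' * cnj c - of_real \<gamma> * c' * cnj b)"
    and "wirtinger_zbar (in_chart f) A = - k * (of_real \<beta> * b' * c - of_real \<gamma> * c' * b)"
proof -
  have \<alpha>: "\<alpha> \<noteq> 0"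
    using f by (auto simp: diagonal_map_def)
  have "coord b c 0 = 0" "coord c b 0 = 0"
    by (simp_all add: coord_def det2_alt)
  then have der: "(in_chart f has_derivative
      (\<lambda>h. (\<beta> * (coord b c h * \<alpha>) / \<alpha>\<^sup>2) *\<^sub>R b' + (\<gamma> * (coord c b h * \<alpha>) / \<alpha>\<^sup>2) *\<^sub>R c')) (at A)"
    using has_derivative_in_chart_diagonal_map[OF f d[unfolded b_def c_def], of A] \<alpha>
    unfolding b_def c_def b'_def c'_def by simp
  define p q where "p = complex_of_real (\<beta> / \<alpha>)" and "q = complex_of_real (\<gamma> / \<alpha>)"
  have "partial_x (in_chart f) A = p * b' * of_real (coord b c 1) + q * c' * of_real (coord c b 1)"
    "partial_y (in_chart f) A = p * b' * of_real (coord b c \<i>) + q * c' * of_real (coord c b \<i>)"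
    unfolding partial_x_def partial_y_def frechet_derivative_at[OF der, symmetric]
    using \<alpha> by (simp_all add: scaleR_conv_of_real p_def q_def power2_eq_square mult_ac)
  note partial = this
  have c_b: "det2 c b = - det2 b c"
    by (simp add: det2_alt)
  have "wirtinger_z (in_chart f) A = (p * b' * (of_real (coord b c 1) - \<i> * of_real (coord b c \<i>)) +
      q * c' * (of_real (coord c b 1) - \<i> * of_real (coord c b \<i>))) / 2"
    by (simp add: wirtinger_z_def partial algebra_simps)
  then show "wirtinger_z (in_chart f) A = k * (of_real \<beta> * b' * cnj c - of_real \<gamma> * c' * cnj b)"
    using d \<alpha> unfolding coord_wirtinger c_b by (simp add: p_def q_def k_def field_simps)
  have "wirtinger_zbar (in_chart f) A = (p * b' * (of_real (coord b c 1) + \<i> * of_real (coord b c \<i>)) +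
      q * c' * (of_real (coord c b 1) + \<i> * of_real (coord c b \<i>))) / 2"
    by (simp add: wirtinger_zbar_def partial algebra_simps)
  then show "wirtinger_zbar (in_chart f) A = - k * (of_real \<beta> * b' * c - of_real \<gamma> * c' * b)"
    using d \<alpha> unfolding coord_wirtinger c_b by (simp add: p_def q_def k_def field_simps)
qed

text \<open>
  With \<open>P = p \<bar>b'\<bar> \<bar>c\<bar>\<close> and \<open>Q = q \<bar>c'\<bar> \<bar>b\<bar>\<close> the squared moduli of the numerator and of the denominator are
  \<open>P\<^sup>2 + Q\<^sup>2 - 2 p q m\<close> and \<open>P\<^sup>2 + Q\<^sup>2 - 2 p q n\<close>.  The numbers \<open>m\<close> and \<open>n\<close> do not depend on \<open>p\<close> and \<open>q\<close>: they
  are \<open>K\<close> times the cosines of the difference and of the sum of the two angles, where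
  \<open>K = \<bar>b\<bar> \<bar>c\<bar> \<bar>b'\<bar> \<bar>c'\<bar>\<close>.  By \<open>n < m \<le> K\<close> and \<open>P\<^sup>2 + Q\<^sup>2 \<ge> 2 P Q = 2 p q K\<close> the denominator is positive
  and the squared quotient is at least \<open>(K - m) / (K - n)\<close>, the value for \<open>P = Q\<close>.
\<close>

lemma wirtinger_quotient_minimal:
  fixes b c b' c' :: complex and p q p0 q0 :: real
  assumes same: "det2 b c * det2 b' c' > 0"
    and pos: "p > 0" "q > 0" "p0 > 0" "q0 > 0"
    and balanced: "p0 * norm b' * norm c = q0 * norm c' * norm b"
  shows "of_real p * b' * cnj c - of_real q * c' * cnj b \<noteq> 0"
    and "norm (of_real p0 * b' * c - of_real q0 * c' * b) /
        norm (of_real p0 * b' * cnj c - of_real q0 * c' * cnj b) \<le>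
      norm (of_real p * b' * c - of_real q * c' * b) /
        norm (of_real p * b' * cnj c - of_real q * c' * cnj b)"
proof -
  define v u where "v p q = of_real p * b' * c - of_real q * c' * b"
    and "u p q = of_real p * b' * cnj c - of_real q * c' * cnj b" for p q :: real
  define x y where "x = b * cnj c" and "y = b' * cnj c'"
  define m n K where "m = Re x * Re y + Im x * Im y" and "n = Re x * Re y - Im x * Im y"
    and "K = norm b * norm c * norm b' * norm c'"
  define S where "S p q = (p * norm b' * norm c)\<^sup>2 + (q * norm c' * norm b)\<^sup>2" for p q
  have v: "(norm (v p q))\<^sup>2 = S p q - 2 * p * q * m" for p q
    unfolding v_def S_def m_def x_def y_def power_mult_distrib cmod_power2
    by simp algebra
  have u: "(norm (u p q))\<^sup>2 = S p q - 2 * p * q * n" for p q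
    unfolding u_def S_def n_def x_def y_def power_mult_distrib cmod_power2
    by simp algebra
  \<comment> \<open>Equal orientation puts both angles on the same side, which separates \<open>n\<close> from \<open>m\<close>.\<close>
  have "Im x * Im y = det2 b c * det2 b' c'"
    by (simp add: x_def y_def det2_alt algebra_simps)
  then have nm: "n < m"
    using same by (simp add: m_def n_def)
  have "m = x \<bullet> y"
    by (simp add: m_def inner_complex_def)
  then have mK: "m \<le> K"
    using norm_cauchy_schwarz[of x y] by (simp add: K_def x_def y_def norm_mult mult_ac)
  have S: "S p q \<ge> 2 * p * q * K" for p q
    using sum_squares_bound[of "p * norm b' * norm c" "q * norm c' * norm b"]
    by (simp add: S_def K_def mult_ac)
  have S0: "S p0 q0 = 2 * p0 * q0 * K"
  proof -
    have "S p0 q0 = 2 * (p0 * norm b' * norm c) * (q0 * norm c' * norm b)"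
      unfolding S_def balanced by (simp add: power2_eq_square)
    then show ?thesis
      by (simp add: K_def mult_ac)
  qed
  have u_pos: "S p q - 2 * p * q * n > 0" if "p > 0" "q > 0" for p q
  proof -
    have "2 * p * q * n < 2 * p * q * K"
      using that nm mK by simp
    then show ?thesis
      using S[of p q] by linarith
  qed
  show "of_real p * b' * cnj c - of_real q * c' * cnj b \<noteq> 0"
    using u_pos[OF pos(1,2)] u[of p q] by (auto simp: u_def)
  have "(norm (v p0 q0) / norm (u p0 q0))\<^sup>2 = (2 * p0 * q0 * (K - m)) / (2 * p0 * q0 * (K - n))"
    unfolding power_divide u v S0 by (simp only: right_diff_distrib)
  also have "\<dots> = (K - m) / (K - n)"
    using pos by simp
  also have "\<dots> \<le> (S p q - 2 * p * q * m) / (S p q - 2 * p * q * n)"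
  proof -
    have "(S p q - 2 * p * q * m) * (K - n) - (K - m) * (S p q - 2 * p * q * n) =
        (m - n) * (S p q - 2 * p * q * K)"
      by algebra
    also have "\<dots> \<ge> 0"
      using nm S[of p q] by simp
    finally show ?thesis
      using nm mK u_pos[OF pos(1,2)] by (simp add: divide_le_eq pos_le_divide_eq field_simps)
  qed
  also have "\<dots> = (norm (v p q) / norm (u p q))\<^sup>2"
    unfolding power_divide u v ..
  finally have "norm (v p0 q0) / norm (u p0 q0) \<le> norm (v p q) / norm (u p q)"
    by (rule power2_le_imp_le) simp
  then show "norm (of_real p0 * b' * c - of_real q0 * c' * b) /
        norm (of_real p0 * b' * cnj c - of_real q0 * c' * cnj b) \<le>
      norm (of_real p * b' * c - of_real q * c' * b) /
        norm (of_real p * b' * cnj c - of_real q * c' * cnj b)"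
    by (simp add: u_def v_def)
qed

lemma eccentricity_diagonal_map:
  fixes A B C A' B' C' :: complex and \<alpha> \<beta> \<gamma> :: real
  defines "b \<equiv> B - A" and "c \<equiv> C - A" and "b' \<equiv> B' - A'" and "c' \<equiv> C' - A'"
  assumes f: "diagonal_map A B C A' B' C' f \<alpha> \<beta> \<gamma>" and d: "det2 b c \<noteq> 0"
    and nz: "of_real \<beta> * b' * cnj c - of_real \<gamma> * c' * cnj b \<noteq> 0"
  shows "eccentricity (in_chart f) A = ennreal (norm (of_real \<beta> * b' * c - of_real \<gamma> * c' * b) /
    norm (of_real \<beta> * b' * cnj c - of_real \<gamma> * c' * cnj b))"
proof -
  define k where "k = \<i> / of_real (2 * \<alpha> * det2 b c)"
  have "k \<noteq> 0"
    using f d by (auto simp: k_def diagonal_map_def)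
  moreover have
    "wirtinger_z (in_chart f) A = k * (of_real \<beta> * b' * cnj c - of_real \<gamma> * c' * cnj b)"
    "wirtinger_zbar (in_chart f) A = - k * (of_real \<beta> * b' * c - of_real \<gamma> * c' * b)"
    using wirtinger_diagonal_map[OF f d[unfolded b_def c_def]]
    unfolding k_def b_def c_def b'_def c'_def by simp_all
  ultimately show ?thesis
    using nz by (simp add: eccentricity_def beltrami_def norm_divide norm_mult)
qed

lemma eccentricity_bisector_minimal:
  assumes same: "det2 (B - A) (C - A) * det2 (B' - A') (C' - A') > 0"
    and f: "diagonal_map A B C A' B' C' f \<alpha>0 \<beta>0 \<gamma>0"
    and g: "diagonal_map A B C A' B' C' g \<alpha> \<beta> \<gamma>"
    and bis: "f ` affine_point ` angle_bisector A B C = affine_point ` angle_bisector A' B' C'"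
  shows "eccentricity (in_chart f) A \<le> eccentricity (in_chart g) A"
proof -
  have d: "det2 (B - A) (C - A) \<noteq> 0" "det2 (B' - A') (C' - A') \<noteq> 0"
    using same by auto
  have pos: "\<beta>0 > 0" "\<gamma>0 > 0" "\<beta> > 0" "\<gamma> > 0"
    using f g by (auto simp: diagonal_map_def)
  have bal: "\<beta>0 * norm (B' - A') * norm (C - A) = \<gamma>0 * norm (C' - A') * norm (B - A)"
    using bis diagonal_map_bisector_iff[OF f d] by (simp add: mult_ac)
  note min = wirtinger_quotient_minimal[OF same _ _ pos(1,2) bal]
  show ?thesis
    unfolding eccentricity_diagonal_map[OF f d(1) min(1)[OF pos(1,2)]]
      eccentricity_diagonal_map[OF g d(1) min(1)[OF pos(3,4)]]
    by (intro ennreal_leI min(2) pos)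
qed

section \<open>The bisector preserving map\<close>

lemma bisector_preserving_imp_maps_triangle:
  "bisector_preserving A B C A' B' C' f \<Longrightarrow> maps_triangle A B C A' B' C' f"
  unfolding bisector_preserving_def by (rule conjunct1)

lemma bisector_preserving_iff_weights:
  assumes d: "det2 (B - A) (C - A) \<noteq> 0" and d': "det2 (B' - A') (C' - A') \<noteq> 0"
    and f: "diagonal_map A B C A' B' C' f \<alpha> \<beta> \<gamma>"
  shows "bisector_preserving A B C A' B' C' f \<longleftrightarrow> maps_triangle A B C A' B' C' f \<and>
    \<beta> * norm (C - A) * norm (B' - A') = \<gamma> * norm (B - A) * norm (C' - A') \<and>
    \<gamma> * norm (A - B) * norm (C' - B') = \<alpha> * norm (C - B) * norm (A' - B') \<and>
    \<alpha> * norm (B - C) * norm (A' - C') = \<beta> * norm (A - C) * norm (B' - C')"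
proof -
  note f2 = diagonal_map_rotate[OF f]
  note f3 = diagonal_map_rotate[OF f2]
  have "det2 (C - B) (A - B) \<noteq> 0" "det2 (C' - B') (A' - B') \<noteq> 0"
    "det2 (A - C) (B - C) \<noteq> 0" "det2 (A' - C') (B' - C') \<noteq> 0"
    using d d' det2_rotate[where A = A and B = B and C = C]
      det2_rotate[where A = A' and B = B' and C = C'] by simp_all
  then show ?thesis
    unfolding bisector_preserving_def
    using diagonal_map_bisector_iff[OF f d d'] diagonal_map_bisector_iff[OF f2]
      diagonal_map_bisector_iff[OF f3] by simp
qed

text \<open>The weights are the ratios of corresponding side lengths, each attached to the opposite vertex.\<close>

lemma bisector_preserving_exists:
  assumes d: "det2 (B - A) (C - A) \<noteq> 0" and d': "det2 (B' - A') (C' - A') \<noteq> 0"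
  obtains f where "bisector_preserving A B C A' B' C' f"
proof -
  define l l' where "l = norm (C - B)" and "l' = norm (C' - B')"
  define m m' where "m = norm (A - C)" and "m' = norm (A' - C')"
  define n n' where "n = norm (B - A)" and "n' = norm (B' - A')"
  have "B \<noteq> A" "C \<noteq> A" "C \<noteq> B" "B' \<noteq> A'" "C' \<noteq> A'" "C' \<noteq> B'"
    using d d' by (auto simp: det2_alt)
  then have pos: "l > 0" "m > 0" "n > 0" "l' > 0" "m' > 0" "n' > 0"
    by (auto simp: l_def m_def n_def l'_def m'_def n'_def)
  obtain f where f: "projective_transformation f"
    "diagonal_map A B C A' B' C' f (l' / l) (m' / m) (n' / n)"
    using diagonal_map_exists[OF d d'] pos by (metis divide_pos_pos)
  have "maps_triangle A B C A' B' C' f"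
    using f by (rule diagonal_map_imp_maps_triangle)
  moreover have "norm (C - A) = m" "norm (B - C) = l" "norm (A - B) = n"
    "norm (C' - A') = m'" "norm (B' - C') = l'" "norm (A' - B') = n'"
    by (simp_all add: l_def m_def n_def l'_def m'_def n'_def norm_minus_commute)
  ultimately have "bisector_preserving A B C A' B' C' f"
    unfolding bisector_preserving_iff_weights[OF d d' f(2)]
    using pos by (simp add: l_def[symmetric] m_def[symmetric] n_def[symmetric]
        l'_def[symmetric] m'_def[symmetric] n'_def[symmetric])
  then show thesis
    by (rule that)
qed

text \<open>
  The conditions at \<open>A\<close> and \<open>B\<close> express \<open>\<beta>\<close> and \<open>\<alpha>\<close> as fixed multiples of \<open>\<gamma>\<close>, so that the weights of any
  two such maps are proportional.
\<close>

lemma bisector_preserving_unique: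
  assumes d: "det2 (B - A) (C - A) \<noteq> 0" and d': "det2 (B' - A') (C' - A') \<noteq> 0"
    and f: "bisector_preserving A B C A' B' C' f" and g: "bisector_preserving A B C A' B' C' g"
  shows "f = g"
proof -
  obtain \<alpha> \<beta> \<gamma> where df: "diagonal_map A B C A' B' C' f \<alpha> \<beta> \<gamma>"
    using maps_triangle_imp_diagonal_map[OF bisector_preserving_imp_maps_triangle[OF f] d] .
  obtain \<alpha>1 \<beta>1 \<gamma>1 where dg: "diagonal_map A B C A' B' C' g \<alpha>1 \<beta>1 \<gamma>1"
    using maps_triangle_imp_diagonal_map[OF bisector_preserving_imp_maps_triangle[OF g] d] .
  note wf = f[unfolded bisector_preserving_iff_weights[OF d d' df]]
  note wg = g[unfolded bisector_preserving_iff_weights[OF d d' dg]]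
  have nz: "norm (C - A) \<noteq> 0" "norm (B' - A') \<noteq> 0" "norm (C - B) \<noteq> 0" "norm (A' - B') \<noteq> 0"
    using d d' by (auto simp: det2_alt)
  have solve: "u = v * (z * w / (x * y))" if "u * x * y = v * z * w" "x \<noteq> 0" "y \<noteq> 0"
    for u v w x y z :: real
    using that by (simp add: nonzero_eq_divide_eq mult.assoc)
  define r1 r2 where "r1 = norm (B - A) * norm (C' - A') / (norm (C - A) * norm (B' - A'))"
    and "r2 = norm (A - B) * norm (C' - B') / (norm (C - B) * norm (A' - B'))"
  have "\<beta> = \<gamma> * r1" "\<beta>1 = \<gamma>1 * r1"
    unfolding r1_def using wf wg by (intro solve nz; blast)+
  moreover have "\<alpha> = \<gamma> * r2" "\<alpha>1 = \<gamma>1 * r2"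
    unfolding r2_def using wf wg by (intro solve nz; metis)+
  ultimately have ratio: "\<beta> = \<gamma> * r1" "\<beta>1 = \<gamma>1 * r1" "\<alpha> = \<gamma> * r2" "\<alpha>1 = \<gamma>1 * r2" .
  have "\<gamma> > 0"
    using df by (auto simp: diagonal_map_def)
  then have "diagonal_map A B C A' B' C' g (\<gamma>1 / \<gamma> * \<alpha>) (\<gamma>1 / \<gamma> * \<beta>) (\<gamma>1 / \<gamma> * \<gamma>)"
    using dg unfolding ratio by simp
  then show ?thesis
    by (rule diagonal_map_unique[OF d df])
qed

theorem theorem5p1:
  fixes A B C A' B' C' :: complex
  assumes "\<not> collinear {A, B, C}"
    and "\<not> collinear {A', B', C'}"
    and "orientation A B C = orientation A' B' C'"
  shows "(\<forall>g. maps_triangle A B C A' B' C' g \<longrightarrow>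
            (\<forall>z\<in>triangle_region A B C. orientation_preserving_at (in_chart g) z)) \<and>
         (\<exists>!f. bisector_preserving A B C A' B' C' f) \<and>
         (\<forall>f g. bisector_preserving A B C A' B' C' f \<longrightarrow> maps_triangle A B C A' B' C' g \<longrightarrow>
            eccentricity (in_chart f) A \<le> eccentricity (in_chart g) A \<and>
            eccentricity (in_chart f) B \<le> eccentricity (in_chart g) B \<and>
            eccentricity (in_chart f) C \<le> eccentricity (in_chart g) C)"
proof -
  have d: "det2 (B - A) (C - A) \<noteq> 0" and d': "det2 (B' - A') (C' - A') \<noteq> 0"
    using assms det2_nonzero_if_noncollinear by blast+
  then have same: "det2 (B - A) (C - A) * det2 (B' - A') (C' - A') > 0"
    using assms(3) by (auto simp: orientation_det2 sgn_if zero_less_mult_iff split: if_splits)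
  have oriented: "orientation_preserving_at (in_chart g) z"
    if "maps_triangle A B C A' B' C' g" "z \<in> triangle_region A B C" for g z
    by (rule maps_triangle_imp_diagonal_map[OF that(1) d])
      (rule orientation_preserving_diagonal_map[OF _ same that(2)])
  have unique: "\<exists>!f. bisector_preserving A B C A' B' C' f"
    by (rule bisector_preserving_exists[OF d d'])
      (blast intro: bisector_preserving_unique[OF d d'])
  have minimal: "eccentricity (in_chart f) A \<le> eccentricity (in_chart g) A \<and>
      eccentricity (in_chart f) B \<le> eccentricity (in_chart g) B \<and>
      eccentricity (in_chart f) C \<le> eccentricity (in_chart g) C"
    if f: "bisector_preserving A B C A' B' C' f" and g: "maps_triangle A B C A' B' C' g" for f g
  proof -
    obtain \<alpha>0 \<beta>0 \<gamma>0 where f1: "diagonal_map A B C A' B' C' f \<alpha>0 \<beta>0 \<gamma>0"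
      using maps_triangle_imp_diagonal_map[OF bisector_preserving_imp_maps_triangle[OF f] d] .
    obtain \<alpha> \<beta> \<gamma> where g1: "diagonal_map A B C A' B' C' g \<alpha> \<beta> \<gamma>"
      using maps_triangle_imp_diagonal_map[OF g d] .
    note f2 = diagonal_map_rotate[OF f1] and g2 = diagonal_map_rotate[OF g1]
    note f3 = diagonal_map_rotate[OF f2] and g3 = diagonal_map_rotate[OF g2]
    have same2: "det2 (C - B) (A - B) * det2 (C' - B') (A' - B') > 0"
      and same3: "det2 (A - C) (B - C) * det2 (A' - C') (B' - C') > 0"
      using same det2_rotate[where A = A and B = B and C = C]
        det2_rotate[where A = A' and B = B' and C = C'] by simp_all
    show ?thesis
      using f eccentricity_bisector_minimal[OF same f1 g1]
        eccentricity_bisector_minimal[OF same2 f2 g2] eccentricity_bisector_minimal[OF same3 f3 g3]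
      by (simp add: bisector_preserving_def)
  qed
  show ?thesis
    using oriented unique minimal by blast
qed

end
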